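(* The extreme points of $\Theta_3$ are precisely the rank one elements of $\Theta_3$. Moreover, $$\mathcal{C}_3=\mathcal{F}_3=\mathcal{G}_3=\Theta_3.$$
   Context: A correlation matrix is a complex, positive semidefinite matrix having all diagonal entries equal to $1$; $\Theta_n$ denotes the (convex) set of all $n\times n$ correlation matrices. $\mathcal{G}_n$ is the set of all $n\times n$ matrices of the form $X=\big(\tau(U_i^*U_j)\big)_{1\le i,j\le n}$ as $(U_1,\ldots,U_n)$ runs over all $n$-tuples of unitaries in all (unital) $C^*$-algebras $A$ possessing a faithful tracial state $\tau$. $\mathcal{F}_n$ is the closure (in $M_n(\mathbf{C})$) of the set $\{(\mathrm{tr}_k(V_i^*V_j))_{1\le i,j\le n}\mid k\in\mathbf{N},\ V_1,\ldots,V_n\in\mathcal{U}_k\}$, where $\mathcal{U}_k$ is the group of $k\times k$ unitary matrices and $\mathrm{tr}_k$ is the normalized trace on $M_k(\mathbf{C})$. $\mathcal{C}_n$ is the convex hull of $\{X\in\Theta_n\mid \mathrm{rank}(X)=1\}$. *)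

theory Defs
  imports
    "HOL-Analysis.Analysis"
    "HOL-Algebra.Module"
    "Jordan_Normal_Form.VS_Connect"
    "Jordan_Normal_Form.Schur_Decomposition"
begin

text \<open>
  The outer \<open>n \<times> n\<close> matrices are of type \<^typ>\<open>complex^'n^'n\<close>, so that convex hulls, closures,
  extreme points and rank are those of HOL-Analysis. Square matrices of arbitrary size
  \<open>k\<close>, which ranges inside a definition below, are of type \<^typ>\<open>complex mat\<close>.
\<close>

section \<open>Correlation matrices\<close>

definition pos_semidef :: "complex^'n^'n \<Rightarrow> bool" where
  "pos_semidef X \<longleftrightarrow>
     (\<forall>v :: complex^'n.
        (\<Sum>i\<in>UNIV. \<Sum>j\<in>UNIV. cnj (vec_nth v i) * vec_nth (vec_nth X i) j * vec_nth v j) \<in> \<real>\<^sub>\<ge>\<^sub>0)"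

definition correlation_matrices :: "(complex^'n^'n) set"  (\<open>\<Theta>\<close>) where
  "\<Theta> = {X. pos_semidef X \<and> (\<forall>i. vec_nth (vec_nth X i) i = 1)}"

definition rank_one_hull :: "(complex^'n^'n) set"  (\<open>\<C>\<close>) where
  "\<C> = convex hull {X \<in> \<Theta>. rank X = 1}"


section \<open>Correlations of unitary matrices\<close>

definition unitary_group :: "nat \<Rightarrow> complex mat set" where
  "unitary_group k =
     {V \<in> carrier_mat k k. mat_adjoint V * V = 1\<^sub>m k \<and> V * mat_adjoint V = 1\<^sub>m k}"

definition normalized_trace :: "nat \<Rightarrow> complex mat \<Rightarrow> complex" where
  "normalized_trace k M = (\<Sum>a<k. M $$ (a, a)) / of_nat k"

definition matrix_unitary_correlations :: "(complex^'n^'n) set"  (\<open>\<F>\<close>) where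
  "\<F> = closure {(\<chi> i j. normalized_trace k (mat_adjoint (V i) * V j)) | k V.
                   k \<ge> 1 \<and> (\<forall>i. V i \<in> unitary_group k)}"


section \<open>Correlations of unitaries in tracial \<open>C\<^sup>*\<close>-algebras\<close>

record 'a cstar = "(complex, 'a) module" +
  adj :: "'a \<Rightarrow> 'a"
  nrm :: "'a \<Rightarrow> real"

text \<open>Here \<^term>\<open>class_ring\<close> is the field of complex numbers as a ring record.\<close>

locale unital_cstar_algebra = module "class_ring :: complex ring" A + ring A
  for A :: "'a cstar" (structure) +
  assumes smult_mult_left:
      "x \<in> carrier A \<Longrightarrow> y \<in> carrier A \<Longrightarrow> (c \<odot> x) \<otimes> y = c \<odot> (x \<otimes> y)"
    and smult_mult_right:
      "x \<in> carrier A \<Longrightarrow> y \<in> carrier A \<Longrightarrow> x \<otimes> (c \<odot> y) = c \<odot> (x \<otimes> y)"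
    and nrm_nonneg: "x \<in> carrier A \<Longrightarrow> 0 \<le> nrm A x"
    and nrm_eq_0: "x \<in> carrier A \<Longrightarrow> nrm A x = 0 \<longleftrightarrow> x = \<zero>"
    and nrm_triangle:
      "x \<in> carrier A \<Longrightarrow> y \<in> carrier A \<Longrightarrow> nrm A (x \<oplus> y) \<le> nrm A x + nrm A y"
    and nrm_smult: "x \<in> carrier A \<Longrightarrow> nrm A (c \<odot> x) = cmod c * nrm A x"
    and nrm_mult:
      "x \<in> carrier A \<Longrightarrow> y \<in> carrier A \<Longrightarrow> nrm A (x \<otimes> y) \<le> nrm A x * nrm A y"
    and complete:
      "(\<And>n. \<sigma> n \<in> carrier A) \<Longrightarrow>
       (\<And>e. e > 0 \<Longrightarrow> \<exists>N. \<forall>m\<ge>N. \<forall>n\<ge>N. nrm A (\<sigma> m \<ominus> \<sigma> n) < e) \<Longrightarrow>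
       \<exists>x\<in>carrier A. (\<lambda>n::nat. nrm A (\<sigma> n \<ominus> x)) \<longlonglongrightarrow> 0"
    and adj_closed: "x \<in> carrier A \<Longrightarrow> adj A x \<in> carrier A"
    and adj_adj: "x \<in> carrier A \<Longrightarrow> adj A (adj A x) = x"
    and adj_add:
      "x \<in> carrier A \<Longrightarrow> y \<in> carrier A \<Longrightarrow> adj A (x \<oplus> y) = adj A x \<oplus> adj A y"
    and adj_smult: "x \<in> carrier A \<Longrightarrow> adj A (c \<odot> x) = cnj c \<odot> adj A x"
    and adj_mult:
      "x \<in> carrier A \<Longrightarrow> y \<in> carrier A \<Longrightarrow> adj A (x \<otimes> y) = adj A y \<otimes> adj A x"
    and cstar_identity: "x \<in> carrier A \<Longrightarrow> nrm A (adj A x \<otimes> x) = (nrm A x)\<^sup>2"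

text \<open>
  On a unital \<open>C\<^sup>*\<close>-algebra a state is a positive linear functional with value 1 at the unit;
  the positive elements are those of the form \<open>x\<^sup>* x\<close>.
\<close>

locale faithful_tracial_state = unital_cstar_algebra A
  for A :: "'a cstar" (structure) and \<tau> :: "'a \<Rightarrow> complex" +
  assumes state_add: "x \<in> carrier A \<Longrightarrow> y \<in> carrier A \<Longrightarrow> \<tau> (x \<oplus> y) = \<tau> x + \<tau> y"
    and state_smult: "x \<in> carrier A \<Longrightarrow> \<tau> (c \<odot> x) = c * \<tau> x"
    and state_positive: "x \<in> carrier A \<Longrightarrow> \<tau> (adj A x \<otimes> x) \<in> \<real>\<^sub>\<ge>\<^sub>0"
    and state_one: "\<tau> \<one> = 1"
    and tracial: "x \<in> carrier A \<Longrightarrow> y \<in> carrier A \<Longrightarrow> \<tau> (x \<otimes> y) = \<tau> (y \<otimes> x)"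
    and faithful: "x \<in> carrier A \<Longrightarrow> \<tau> (adj A x \<otimes> x) = 0 \<Longrightarrow> x = \<zero>"

definition unitaries :: "'a cstar \<Rightarrow> 'a set" where
  "unitaries A = {u \<in> carrier A. adj A u \<otimes>\<^bsub>A\<^esub> u = \<one>\<^bsub>A\<^esub> \<and> u \<otimes>\<^bsub>A\<^esub> adj A u = \<one>\<^bsub>A\<^esub>}"

text \<open>
  HOL cannot form a union over all types, so the set depends on a type \<^typ>\<open>'a\<close> serving as the
  universe: it ranges over all \<open>C\<^sup>*\<close>-algebras whose carrier is a subset of \<^typ>\<open>'a\<close>. Algebras
  may be transported along injections, so enlarging the universe can only enlarge the set; and
  since finitely many unitaries generate a \<open>C\<^sup>*\<close>-subalgebra of cardinality at most that of the
  continuum (to which \<open>\<tau>\<close> restricts), all universes with at least continuum many elements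
  give the same set, the one obtained from all \<open>C\<^sup>*\<close>-algebras.
\<close>

definition tracial_unitary_correlations :: "'a itself \<Rightarrow> (complex^'n^'n) set"  (\<open>\<G>\<close>) where
  "\<G> (_ :: 'a itself) =
     {(\<chi> i j. \<tau> (adj A (U i) \<otimes>\<^bsub>A\<^esub> U j)) | (A :: 'a cstar) \<tau> U.
        faithful_tracial_state A \<tau> \<and> (\<forall>i. U i \<in> unitaries A)}"

end

theory Submission
  imports Defs
begin

text \<open>
  Every entry of a rank one correlation matrix has modulus \<open>1\<close>, so it is extreme by strict convexity
  of the disc. Conversely, if some entry of \<open>X \<in> \<Theta>\<close> has modulus less than \<open>1\<close>, two columns of \<open>X\<close>
  are independent. The Hermitian matrices supported on their span form a real space of dimension
  \<open>4\<close>, and a zero diagonal is only \<open>3\<close> linear conditions; a nonzero solution \<open>H\<close> is dominated by the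
  form of \<open>X\<close>, so \<open>X \<plusminus> tH \<in> \<Theta>\<close> for small \<open>t\<close> and \<open>X\<close> is not extreme.

  By Krein--Milman \<open>\<Theta> = \<C>\<close>. Averages of rank one correlation matrices come from diagonal unitaries,
  whose entries list the phases, and the closure of these averages is midpoint convex, hence convex;
  this gives \<open>\<C> \<subseteq> \<F>\<close>. A convex combination of rank one correlation matrices comes from unitaries in
  a finite-dimensional commutative algebra whose trace is given by the weights, so \<open>\<C> \<subseteq> \<G>\<close>.
  Correlations of unitaries are Gram matrices of the trace form, so \<open>\<F>\<close> and \<open>\<G>\<close> lie in \<open>\<Theta>\<close>.
\<close>


section \<open>The sesquilinear form of a matrix\<close>

abbreviation entry :: "complex^'n^'n \<Rightarrow> 'n \<Rightarrow> 'n \<Rightarrow> complex" where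
  "entry X i j \<equiv> vec_nth (vec_nth X i) j"

text \<open>Positivity only concerns the diagonal values \<open>sform X v v\<close>. Two separate
  arguments make polarisation and Cauchy-Schwarz available; the first one is
  conjugate-linear.\<close>

definition sform :: "complex^'n^'n \<Rightarrow> complex^'n \<Rightarrow> complex^'n \<Rightarrow> complex" where
  "sform X u v = (\<Sum>i\<in>UNIV. \<Sum>j\<in>UNIV. cnj (vec_nth u i) * entry X i j * vec_nth v j)"

lemma pos_semidef_iff: "pos_semidef X \<longleftrightarrow> (\<forall>v. sform X v v \<in> \<real>\<^sub>\<ge>\<^sub>0)"
  by (simp add: pos_semidef_def sform_def)

lemma sform_diff_left: "sform X (u - v) w = sform X u w - sform X v w"
  and sform_add_left: "sform X (u + v) w = sform X u w + sform X v w"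
  and sform_diff_right: "sform X w (u - v) = sform X w u - sform X w v"
  and sform_add_right: "sform X w (u + v) = sform X w u + sform X w v"
  and sform_smult_left: "sform X (c *s u) w = cnj c * sform X u w"
  and sform_smult_right: "sform X w (c *s u) = c * sform X w u"
  by (simp_all add: sform_def algebra_simps sum.distrib sum_subtractf sum_distrib_left)

lemmas sform_sesquilinear =
  sform_diff_left sform_add_left sform_diff_right sform_add_right sform_smult_left sform_smult_right

lemma sform_add: "sform (X + Y) u v = sform X u v + sform Y u v"
  and sform_scaleR: "sform (r *\<^sub>R X) u v = r *\<^sub>R sform X u v"
  by (simp_all add: sform_def algebra_simps sum.distrib sum_subtractf scaleR_sum_right)

lemma sform_axis_left: "sform X (axis i 1) v = (\<Sum>j\<in>UNIV. entry X i j * vec_nth v j)"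
proof -
  have "sform X (axis i 1) v =
      (\<Sum>i'\<in>UNIV. if i' = i then \<Sum>j\<in>UNIV. entry X i' j * vec_nth v j else 0)"
    unfolding sform_def by (rule sum.cong) (auto simp: axis_def)
  then show ?thesis by simp
qed

lemma sform_axis: "sform X (axis i 1) (axis j 1) = entry X i j"
  unfolding sform_axis_left by (simp add: axis_def if_distrib cong: if_cong)

lemma sform_outer:
  "sform (\<chi> i j. a i * cnj (b j)) v v =
    cnj (\<Sum>i\<in>UNIV. cnj (a i) * vec_nth v i) * (\<Sum>j\<in>UNIV. cnj (b j) * vec_nth v j)"
  by (simp add: sform_def sum_product algebra_simps)

lemma correlation_form_nonneg: "X \<in> \<Theta> \<Longrightarrow> sform X v v \<in> \<real>\<^sub>\<ge>\<^sub>0"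
  by (simp add: correlation_matrices_def pos_semidef_iff)

lemma correlation_diag: "X \<in> \<Theta> \<Longrightarrow> entry X i i = 1"
  by (simp add: correlation_matrices_def)

text \<open>Polarisation: the diagonal values of the form are real. At e_i + e_j this compares the
  imaginary parts of the two entries, at e_i + \<i> e_j their real parts.\<close>

lemma correlation_hermitian:
  assumes "X \<in> \<Theta>"
  shows "cnj (entry X i j) = entry X j i"
proof -
  have im: "Im (sform X v v) = 0" for v
    using correlation_form_nonneg[OF assms] by (auto simp: complex_nonneg_Reals_iff)
  show ?thesis
    using im[of "axis i 1 + axis j 1"] im[of "axis i 1 + \<i> *s axis j 1"]
    by (simp add: sform_sesquilinear sform_axis correlation_diag[OF assms] complex_eq_iff)
qed

lemma sform_hermitian:
  assumes "X \<in> \<Theta>"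
  shows "cnj (sform X u v) = sform X v u"
proof -
  have "cnj (sform X u v) =
      (\<Sum>i\<in>UNIV. \<Sum>j\<in>UNIV. cnj (vec_nth v j) * entry X j i * vec_nth u i)"
    by (simp add: sform_def correlation_hermitian[OF assms] algebra_simps)
  also have "\<dots> = sform X v u"
    unfolding sform_def by (rule sum.swap)
  finally show ?thesis .
qed

text \<open>The unit diagonal makes e_k a unit vector of the form. Subtracting from \<open>v\<close>
  its projection onto e_k lowers the value of the form by |s|^2, and the result is still
  nonnegative.\<close>

lemma correlation_Cauchy_Schwarz:
  assumes "X \<in> \<Theta>"
  shows "(cmod (sform X (axis k 1) v))\<^sup>2 \<le> Re (sform X v v)"
proof -
  define s where "s = sform X (axis k 1) v"
  have "sform X v (axis k 1) = cnj s"
    by (simp add: s_def sform_hermitian[OF assms])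
  then have "sform X (v - s *s axis k 1) (v - s *s axis k 1) = sform X v v - s * cnj s"
    by (simp add: sform_sesquilinear sform_axis correlation_diag[OF assms]
        s_def[symmetric] algebra_simps)
  moreover have "Re (sform X (v - s *s axis k 1) (v - s *s axis k 1)) \<ge> 0"
    using correlation_form_nonneg[OF assms] by (auto simp: complex_nonneg_Reals_iff)
  ultimately show ?thesis
    by (simp add: s_def[symmetric] complex_mult_cnj cmod_power2)
qed

lemma correlation_entry_le_1: "X \<in> \<Theta> \<Longrightarrow> cmod (entry X i j) \<le> 1"
  using correlation_Cauchy_Schwarz[of X i "axis j 1"]
  by (simp add: sform_axis correlation_diag power_le_one_iff abs_square_le_1)

section \<open>Rank one\<close>

lemma unimodular_iff: "cmod z = 1 \<longleftrightarrow> z * cnj z = 1"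
  unfolding complex_norm_square[symmetric] of_real_eq_1_iff abs_square_eq_1 by simp

text \<open>The conjugate sits on the row index to match U_i^* U_j: for unimodular
  \<open>x i\<close> these are the correlations of one-dimensional unitaries.\<close>

definition phase_matrix :: "('n \<Rightarrow> complex) \<Rightarrow> complex^'n^'n" where
  "phase_matrix x = (\<chi> i j. cnj (x i) * x j)"

lemma phase_matrix_correlation:
  assumes "\<And>i. cmod (x i) = 1"
  shows "phase_matrix x \<in> \<Theta>"
proof -
  have "sform (phase_matrix x) v v = complex_of_real ((cmod (\<Sum>j\<in>UNIV. x j * vec_nth v j))\<^sup>2)" for v
    using sform_outer[of "\<lambda>i. cnj (x i)" "\<lambda>i. cnj (x i)" v]
    unfolding phase_matrix_def complex_norm_square by (simp only: complex_cnj_cnj mult.commute)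
  then have "sform (phase_matrix x) v v \<in> \<real>\<^sub>\<ge>\<^sub>0" for v
    by (simp only: complex_nonneg_Reals_iff Re_complex_of_real Im_complex_of_real zero_le_power2)
  moreover have "cnj (x i) * x i = 1" for i
    using assms[of i] by (simp only: unimodular_iff mult.commute)
  ultimately show ?thesis
    by (simp add: correlation_matrices_def pos_semidef_iff phase_matrix_def)
qed

text \<open>Equality case of Cauchy-Schwarz: since X_kj has modulus 1, the vector e_j - X_kj e_k is
  null for the form, hence orthogonal to every e_i. Thus row \<open>k\<close> determines all
  entries.\<close>

lemma unimodular_correlation_phase_matrix:
  assumes X: "X \<in> \<Theta>" and unimod: "\<And>j. cmod (entry X k j) = 1"
  shows "X = phase_matrix (\<lambda>j. entry X k j)"
proof -
  have "entry X i j = cnj (entry X k i) * entry X k j" for i j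
  proof -
    define v where "v = axis j 1 - entry X k j *s axis k (1::complex)"
    have "sform X v v = 1 - entry X k j * cnj (entry X k j)"
      by (simp add: v_def sform_sesquilinear sform_axis correlation_diag[OF X]
          correlation_hermitian[OF X] algebra_simps)
    also have "\<dots> = 0"
      using unimod[of j] by (simp only: unimodular_iff diff_self)
    finally have "sform X (axis i 1) v = 0"
      using correlation_Cauchy_Schwarz[OF X, of i v] by simp
    then show ?thesis
      by (simp add: v_def sform_sesquilinear sform_axis correlation_hermitian[OF X] algebra_simps)
  qed
  then show ?thesis
    unfolding phase_matrix_def Finite_Cartesian_Product.vec_eq_iff vec_lambda_beta by blast
qed

lemma rank_one_correlations:
  "{X \<in> \<Theta>. rank X = 1} = phase_matrix ` {x. \<forall>i. cmod (x i) = 1}"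
proof (intro equalityI subsetI)
  fix X :: "complex^'n^'n"
  assume "X \<in> {X \<in> \<Theta>. rank X = 1}"
  then have X: "X \<in> \<Theta>" and "vec.dim (Finite_Cartesian_Product.rows X) = 1"
    by (auto simp: row_rank_def_gen)
  obtain B where "B \<subseteq> Finite_Cartesian_Product.rows X" "vec.independent B" "Finite_Cartesian_Product.rows X \<subseteq> vec.span B"
    "card B = vec.dim (Finite_Cartesian_Product.rows X)"
    by (rule vec.basis_exists)
  moreover from this \<open>vec.dim (Finite_Cartesian_Product.rows X) = 1\<close> obtain b where "B = {b}"
    by (auto simp: card_1_singleton_iff)
  ultimately have b: "b \<in> Finite_Cartesian_Product.rows X" "Finite_Cartesian_Product.rows X \<subseteq> vec.span {b}"
    by auto
  then obtain k where k: "b = vec_nth X k"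
    by (auto simp: Finite_Cartesian_Product.rows_def Finite_Cartesian_Product.row_def Finite_Cartesian_Product.vec_eq_iff)
  have "cmod (entry X k j) = 1" for j
  proof -
    have "vec_nth X j \<in> Finite_Cartesian_Product.rows X"
      by (auto simp: Finite_Cartesian_Product.rows_def Finite_Cartesian_Product.row_def Finite_Cartesian_Product.vec_eq_iff)
    then obtain c where c: "vec_nth X j = c *s vec_nth X k"
      using b k by (auto simp: vec.span_singleton)
    \<comment> \<open>Row \<open>j\<close> is read at the columns \<open>j\<close> and
      \<open>k\<close>, where the unit diagonal is known. As \<open>X\<close> is Hermitian,
      \<open>c\<close> is the conjugate of \<open>entry X k j\<close>.\<close>
    have "1 = c * entry X k j" "entry X j k = c"
      using c correlation_diag[OF X, of j] correlation_diag[OF X, of k]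
      by (simp_all add: Finite_Cartesian_Product.vec_eq_iff)
    then have "entry X k j * cnj (entry X k j) = 1"
      by (simp add: correlation_hermitian[OF X] mult.commute)
    then show ?thesis
      by (simp only: unimodular_iff)
  qed
  with unimodular_correlation_phase_matrix[OF X] show "X \<in> phase_matrix ` {x. \<forall>i. cmod (x i) = 1}"
    by blast
next
  fix X :: "complex^'n^'n"
  assume "X \<in> phase_matrix ` {x. \<forall>i. cmod (x i) = 1}"
  then obtain x where x: "\<And>i. cmod (x i) = 1" and X: "X = phase_matrix x"
    by blast
  fix k :: 'n
  have ne: "x i \<noteq> 0" for i
    using x[of i] by auto
  have "Finite_Cartesian_Product.rows X \<subseteq> vec.span {vec_nth X k}"
  proof
    fix r assume "r \<in> Finite_Cartesian_Product.rows X"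
    then obtain i where "r = vec_nth X i"
      by (auto simp: Finite_Cartesian_Product.rows_def Finite_Cartesian_Product.row_def Finite_Cartesian_Product.vec_eq_iff)
    then have "r = (cnj (x i) / cnj (x k)) *s vec_nth X k"
      using ne by (simp add: X phase_matrix_def Finite_Cartesian_Product.vec_eq_iff)
    then show "r \<in> vec.span {vec_nth X k}"
      by (auto simp: vec.span_singleton)
  qed
  moreover have "vec.independent {vec_nth X k}"
    using ne by (simp add: X phase_matrix_def Finite_Cartesian_Product.vec_eq_iff)
  moreover have "vec_nth X k \<in> Finite_Cartesian_Product.rows X"
    by (auto simp: Finite_Cartesian_Product.rows_def Finite_Cartesian_Product.row_def Finite_Cartesian_Product.vec_eq_iff)
  ultimately have "vec.dim (Finite_Cartesian_Product.rows X) = 1"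
    using vec.dim_unique[of "{vec_nth X k}" "Finite_Cartesian_Product.rows X" 1] by simp
  then show "X \<in> {X \<in> \<Theta>. rank X = 1}"
    using phase_matrix_correlation[of x] x X by (simp add: row_rank_def_gen)
qed

section \<open>Extreme points\<close>

text \<open>Strict convexity of the disc in quantitative form: the squared modulus of the
  combination falls short of the combination of the squared moduli by exactly u(1-u)|a-b|^2.\<close>

lemma unimodular_convex_combination:
  fixes a b :: complex
  assumes "cmod a \<le> 1" "cmod b \<le> 1" "0 < u" "u < 1" "cmod ((1 - u) *\<^sub>R a + u *\<^sub>R b) = 1"
  shows "a = b"
proof -
  have "(cmod ((1 - u) *\<^sub>R a + u *\<^sub>R b))\<^sup>2 + u * (1 - u) * (cmod (a - b))\<^sup>2
      = (1 - u) * (cmod a)\<^sup>2 + u * (cmod b)\<^sup>2"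
    unfolding cmod_power2 by (simp add: power2_eq_square algebra_simps)
  also have "\<dots> \<le> (1 - u) * 1 + u * 1"
    using assms by (intro add_mono mult_left_mono) (auto simp: power_le_one)
  finally have "u * (1 - u) * (cmod (a - b))\<^sup>2 \<le> 0"
    using assms by simp
  then have "(cmod (a - b))\<^sup>2 \<le> 0"
    using assms by (simp add: mult_le_0_iff)
  then show ?thesis by simp
qed

text \<open>All entries lie on the unit circle, while entries of members of \<Theta> stay in the
  disc; strict convexity is applied to each entry separately.\<close>

lemma phase_matrix_extreme:
  assumes "\<And>i. cmod (x i) = 1"
  shows "phase_matrix x extreme_point_of \<Theta>"
  unfolding extreme_point_of_def
proof (intro conjI ballI notI)
  show "phase_matrix x \<in> \<Theta>"
    using assms by (rule phase_matrix_correlation)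
  fix A B
  assume A: "A \<in> \<Theta>" and B: "B \<in> \<Theta>" and "phase_matrix x \<in> open_segment A B"
  then obtain u where u: "0 < u" "u < 1" and eq: "phase_matrix x = (1 - u) *\<^sub>R A + u *\<^sub>R B"
    and "A \<noteq> B"
    by (auto simp: in_segment)
  have "entry A i j = entry B i j" for i j
  proof (rule unimodular_convex_combination[OF _ _ u])
    have "(1 - u) *\<^sub>R entry A i j + u *\<^sub>R entry B i j = entry (phase_matrix x) i j"
      by (simp add: eq)
    then show "cmod ((1 - u) *\<^sub>R entry A i j + u *\<^sub>R entry B i j) = 1"
      by (simp add: phase_matrix_def norm_mult assms)
  qed (use A B correlation_entry_le_1 in auto)
  with \<open>A \<noteq> B\<close> show False
    by (simp add: Finite_Cartesian_Product.vec_eq_iff)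
qed

text \<open>For small t the form of \<open>X\<close> absorbs that of tH with either sign, and the
  zero diagonal of \<open>H\<close> preserves the ones. So \<open>X\<close> is the midpoint of two
  distinct members of \<Theta>.\<close>

lemma not_extreme_if_perturbable:
  assumes X: "X \<in> \<Theta>" and "H \<noteq> 0" and diag: "\<And>i. entry H i i = 0"
    and real: "\<And>v. Im (sform H v v) = 0"
    and bound: "\<And>v. \<bar>Re (sform H v v)\<bar> \<le> K * Re (sform X v v)"
  shows "\<not> X extreme_point_of \<Theta>"
proof -
  \<comment> \<open>Adding 1 to the absolute value gives t > 0 and tK \<le> 1 without a sign
    condition on \<open>K\<close>.\<close>
  define t where "t = 1 / (\<bar>K\<bar> + 1)"
  have t: "t > 0" "t * K \<le> 1"
    by (auto simp: t_def divide_le_eq)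
  have nn: "Re (sform X v v) \<ge> 0" "Im (sform X v v) = 0" for v
    using correlation_form_nonneg[OF X] by (auto simp: complex_nonneg_Reals_iff)
  have "X + r *\<^sub>R H \<in> \<Theta>" if "\<bar>r\<bar> = t" for r
  proof -
    have tH: "\<bar>r * Re (sform H v v)\<bar> \<le> Re (sform X v v)" for v
    proof -
      have "\<bar>r * Re (sform H v v)\<bar> \<le> t * (K * Re (sform X v v))"
        unfolding abs_mult that using t(1) bound[of v] by (intro mult_left_mono) auto
      also have "\<dots> \<le> 1 * Re (sform X v v)"
        unfolding mult.assoc[symmetric] using t nn by (intro mult_right_mono) auto
      finally show ?thesis by simp
    qed
    have "0 \<le> Re (sform X v v) + r * Re (sform H v v)" for v
      using tH[of v] by linarith
    then show ?thesis
      by (simp add: correlation_matrices_def pos_semidef_iff complex_nonneg_Reals_iff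
          sform_add sform_scaleR nn real diag correlation_diag[OF X])
  qed
  from this[of t] this[of "- t"] t have "X + t *\<^sub>R H \<in> \<Theta>" "X - t *\<^sub>R H \<in> \<Theta>"
    by simp_all
  moreover have "X \<in> open_segment (X - t *\<^sub>R H) (X + t *\<^sub>R H)"
  proof -
    have "X = midpoint (X - t *\<^sub>R H) (X + t *\<^sub>R H)"
      by (simp add: midpoint_def scaleR_2[symmetric])
    moreover have "X - t *\<^sub>R H \<noteq> X + t *\<^sub>R H"
    proof
      assume "X - t *\<^sub>R H = X + t *\<^sub>R H"
      then have "(2 * t) *\<^sub>R H = 0"
        unfolding scaleR_scaleR[symmetric] scaleR_2 by (simp add: algebra_simps)
      with t \<open>H \<noteq> 0\<close> show False by simp
    qed
    ultimately show ?thesis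
      by (metis midpoint_in_open_segment)
  qed
  ultimately show ?thesis
    unfolding extreme_point_of_def by blast
qed

text \<open>
  With \<open>p\<close> the \<open>k\<close>-th column of \<open>X\<close> and \<open>q\<close> the combination of the columns \<open>k\<close> and \<open>l\<close> whose
  \<open>k\<close>-th entry vanishes, the matrix \<open>\<gamma> p q\<^sup>* + \<gamma>\<^sup>* q p\<^sup>* + \<beta> q q\<^sup>*\<close> has zero \<open>k\<close>-th diagonal entry.
  The real number \<open>\<beta>\<close> makes the \<open>l\<close>-th diagonal entry vanish, and the remaining diagonal entry
  is one real linear condition on \<open>\<gamma>\<close>, which has a nonzero solution.
\<close>

lemma extreme_correlation_unimodular:
  fixes X :: "complex^'n^'n"
  assumes ext: "X extreme_point_of \<Theta>" and "k \<noteq> l" and three: "UNIV = {k, l, m}"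
  shows "cmod (entry X k l) = 1"
proof (rule ccontr)
  assume "cmod (entry X k l) \<noteq> 1"
  have X: "X \<in> \<Theta>"
    using ext by (simp add: extreme_point_of_def)
  define a where "a = entry X k l"
  define s where "s = 1 - (cmod a)\<^sup>2"
  have "cmod a < 1"
    using \<open>cmod (entry X k l) \<noteq> 1\<close> correlation_entry_le_1[OF X, of k l] by (simp add: a_def)
  then have "s > 0"
    by (simp add: s_def abs_square_less_1)
  \<comment> \<open>For the form of \<open>X\<close>, \<open>w\<close> is orthogonal to e_k and has
    squared length \<open>s\<close>. Hence q = Xw vanishes at \<open>k\<close> and equals
    \<open>s\<close> at \<open>l\<close>.\<close>
  define w where "w = axis l 1 - a *s axis k (1::complex)"
  define p where "p i = entry X i k" for i
  define q where "q i = sform X (axis i 1) w" for i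
  have q_eq: "q i = entry X i l - a * entry X i k" for i
    by (simp add: q_def w_def sform_sesquilinear sform_axis)
  have qk: "q k = 0"
    by (simp add: q_eq correlation_diag[OF X] a_def)
  have ql: "q l = s"
    unfolding q_eq s_def of_real_diff complex_norm_square a_def
    by (simp add: correlation_diag[OF X] correlation_hermitian[OF X])
  \<comment> \<open>Once \<beta> clears the \<open>l\<close>-th diagonal entry of \<open>H\<close>,
    the \<open>m\<close>-th one is 2 Re(\<gamma> z). The choice below makes \<gamma> z purely
    imaginary; for z = 0 any \<gamma> would do.\<close>
  define z where "z = p m * cnj (q m) - p l * (cmod (q m))\<^sup>2 / s"
  define \<gamma> where "\<gamma> = (if z = 0 then 1 else \<i> * cnj z)"
  have "\<gamma> \<noteq> 0" and \<gamma>: "Re (\<gamma> * z) = 0"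
    by (auto simp: \<gamma>_def)
  define \<beta> where "\<beta> = - 2 * Re (\<gamma> * p l) / s"
  define H :: "complex^'n^'n" where
    "H = (\<chi> i j. \<gamma> * p i * cnj (q j)) + (\<chi> i j. cnj \<gamma> * q i * cnj (p j)) + (\<chi> i j. \<beta> * q i * cnj (q j))"
  have H_entry: "entry H i j = \<gamma> * p i * cnj (q j) + cnj \<gamma> * q i * cnj (p j) + \<beta> * q i * cnj (q j)" for i j
    by (simp add: H_def)
  have H_diag: "entry H i i = complex_of_real (2 * Re (\<gamma> * p i * cnj (q i)) + \<beta> * (cmod (q i))\<^sup>2)" for i
    unfolding H_entry cmod_power2 by (simp add: complex_eq_iff power2_eq_square algebra_simps)
  have "entry H k l = \<gamma> * s"
    by (simp add: H_entry qk ql p_def correlation_diag[OF X])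
  with \<open>\<gamma> \<noteq> 0\<close> \<open>s > 0\<close> have "entry H k l \<noteq> 0"
    by simp
  then have "H \<noteq> 0"
    by auto
  moreover have "entry H i i = 0" for i
  proof -
    have "Re (\<gamma> * p m * cnj (q m)) = Re (\<gamma> * p l) * (cmod (q m))\<^sup>2 / s"
    proof -
      have "\<gamma> * p m * cnj (q m) = \<gamma> * z + \<gamma> * p l * complex_of_real ((cmod (q m))\<^sup>2 / s)"
        by (simp add: z_def algebra_simps)
      moreover have "Re (\<gamma> * p l * complex_of_real r) = Re (\<gamma> * p l) * r" for r
        by simp
      ultimately show ?thesis
        using \<gamma> by (simp only: plus_complex.sel times_divide_eq_right add_0)
    qed
    then have "2 * Re (\<gamma> * p m * cnj (q m)) + \<beta> * (cmod (q m))\<^sup>2 = 0"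
    proof -
      have "2 * (A * B / s) + - 2 * A / s * B = 0" for A B :: real
        by (simp add: field_simps)
      then show ?thesis
        using \<open>Re (\<gamma> * p m * cnj (q m)) = _\<close> unfolding \<beta>_def by (simp only:)
    qed
    then have "entry H m m = 0"
      unfolding H_diag by (simp only: of_real_0)
    moreover have "entry H k k = 0"
      by (simp add: H_entry qk)
    moreover have "entry H l l = 0"
    proof -
      have "2 * (A * s) + - 2 * A / s * s\<^sup>2 = 0" for A :: real
        using \<open>s > 0\<close> by (simp add: power2_eq_square)
      moreover have "Re (\<gamma> * p l * cnj (complex_of_real s)) = Re (\<gamma> * p l) * s"
        by simp
      moreover have "(cmod (complex_of_real s))\<^sup>2 = s\<^sup>2"
        by simp
      ultimately show ?thesis
        unfolding H_diag ql \<beta>_def by (simp only: of_real_0)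
    qed
    moreover have "i \<in> {k, l, m}"
      using three by blast
    ultimately show ?thesis
      by blast
  qed
  moreover
  \<comment> \<open>\<open>P\<close> and \<open>Q\<close> are the functionals p^* and q^*. Both are
    combinations of \<open>sform X\<close> against e_k and e_l, so Cauchy-Schwarz controls them by
    the form of \<open>X\<close>.\<close>
  define P where "P v = (\<Sum>i\<in>UNIV. cnj (p i) * vec_nth v i)" for v :: "complex^'n"
  define Q where "Q v = (\<Sum>i\<in>UNIV. cnj (q i) * vec_nth v i)" for v :: "complex^'n"
  have P_eq: "P v = sform X (axis k 1) v" for v
    by (simp add: P_def p_def sform_axis_left correlation_hermitian[OF X])
  have Q_eq: "Q v = sform X (axis l 1) v - cnj a * sform X (axis k 1) v" for v
    by (simp add: Q_def q_eq sform_axis_left correlation_hermitian[OF X] algebra_simps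
        sum_subtractf sum_distrib_left)
  have form_H: "sform H v v = complex_of_real (2 * Re (\<gamma> * cnj (P v) * Q v) + \<beta> * (cmod (Q v))\<^sup>2)" for v
  proof -
    have "sform H v v = \<gamma> * (cnj (P v) * Q v) + cnj \<gamma> * (cnj (Q v) * P v) + \<beta> * (cnj (Q v) * Q v)"
      unfolding H_def sform_add P_def Q_def
      using sform_outer[of "\<lambda>i. \<gamma> * p i" q v] sform_outer[of "\<lambda>i. cnj \<gamma> * q i" p v]
        sform_outer[of "\<lambda>i. \<beta> * q i" q v]
      by (simp add: sum_distrib_left sum_distrib_right mult.assoc)
    then show ?thesis
      unfolding cmod_power2 by (simp add: complex_eq_iff power2_eq_square algebra_simps)
  qed
  \<comment> \<open>With R^2 the form of \<open>X\<close> at \<open>v\<close>, |P| \<le> R, and |Q|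
    \<le> 2R because |a| < 1. The two terms are then at most 2|\<gamma>| R (2R) and |\<beta>|
    (2R)^2, whence both factors 4.\<close>
  moreover have "\<bar>2 * Re (\<gamma> * cnj (P v) * Q v) + \<beta> * (cmod (Q v))\<^sup>2\<bar>
      \<le> (4 * cmod \<gamma> + 4 * \<bar>\<beta>\<bar>) * Re (sform X v v)" for v
  proof -
    define R where "R = sqrt (Re (sform X v v))"
    have "Re (sform X v v) \<ge> 0"
      using correlation_form_nonneg[OF X] by (auto simp: complex_nonneg_Reals_iff)
    then have "R \<ge> 0" and R2: "Re (sform X v v) = R * R"
      by (auto simp: R_def)
    have P: "cmod (sform X (axis i 1) v) \<le> R" for i
      unfolding R_def by (rule real_le_rsqrt) (rule correlation_Cauchy_Schwarz[OF X])
    have Q: "cmod (Q v) \<le> 2 * R"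
    proof -
      have "cmod (Q v) \<le> cmod (sform X (axis l 1) v) + cmod (cnj a * sform X (axis k 1) v)"
        unfolding Q_eq by (rule norm_triangle_ineq4)
      also have "\<dots> \<le> R + 1 * R"
        unfolding norm_mult using \<open>cmod a < 1\<close> P \<open>R \<ge> 0\<close>
        by (intro add_mono mult_mono) auto
      finally show ?thesis by simp
    qed
    have "\<bar>Re (\<gamma> * cnj (P v) * Q v)\<bar> \<le> cmod \<gamma> * cmod (P v) * cmod (Q v)"
      by (metis abs_Re_le_cmod complex_mod_cnj norm_mult)
    also have "\<dots> \<le> cmod \<gamma> * R * (2 * R)"
      using P[of k] Q \<open>R \<ge> 0\<close> by (intro mult_mono) (auto simp: P_eq)
    finally have 1: "\<bar>Re (\<gamma> * cnj (P v) * Q v)\<bar> \<le> 2 * cmod \<gamma> * (R * R)"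
      by (simp add: algebra_simps)
    have "(cmod (Q v))\<^sup>2 \<le> (2 * R)\<^sup>2"
      using Q by (intro power_mono) auto
    then have 2: "\<bar>\<beta> * (cmod (Q v))\<^sup>2\<bar> \<le> \<bar>\<beta>\<bar> * (4 * (R * R))"
      by (simp add: abs_mult power2_eq_square mult_left_mono)
    show ?thesis
      using 1 2 unfolding R2 by (simp add: algebra_simps abs_le_iff)
  qed
  ultimately have "\<not> X extreme_point_of \<Theta>"
    by (intro not_extreme_if_perturbable[OF X, of H "4 * cmod \<gamma> + 4 * \<bar>\<beta>\<bar>"]) auto
  with ext show False by contradiction
qed

lemma extreme_points_correlation_3:
  "{X. X extreme_point_of (\<Theta> :: (complex^3^3) set)} = {X \<in> \<Theta>. rank X = 1}"
proof (intro equalityI subsetI)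
  fix X :: "complex^3^3"
  assume "X \<in> {X. X extreme_point_of \<Theta>}"
  then have ext: "X extreme_point_of \<Theta>" and X: "X \<in> \<Theta>"
    by (auto simp: extreme_point_of_def)
  \<comment> \<open>One unimodular row determines \<open>X\<close>, so row 1 suffices. For each
    off-diagonal position the index left over plays the role of \<open>m\<close>.\<close>
  have "cmod (entry X 1 j) = 1" for j
  proof -
    consider "j = 1" | "j = 2" | "j = 3"
      using exhaust_3 by blast
    then show ?thesis
    proof cases
      case 1
      then show ?thesis by (simp add: correlation_diag[OF X])
    next
      case 2
      then show ?thesis
        using extreme_correlation_unimodular[OF ext, of 1 2 3] UNIV_3 by simp
    next
      case 3
      then show ?thesis
        using extreme_correlation_unimodular[OF ext, of 1 3 2] UNIV_3
        by (simp add: insert_commute)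
    qed
  qed
  then show "X \<in> {X \<in> \<Theta>. rank X = 1}"
    unfolding rank_one_correlations using unimodular_correlation_phase_matrix[OF X, of 1] by blast
next
  fix X :: "complex^3^3"
  assume "X \<in> {X \<in> \<Theta>. rank X = 1}"
  then show "X \<in> {X. X extreme_point_of \<Theta>}"
    unfolding rank_one_correlations using phase_matrix_extreme by blast
qed

section \<open>Compactness and convexity of \<Theta>\<close>

lemma convex_correlations: "convex \<Theta>"
proof (rule convexI)
  fix X Y :: "complex^'n^'n" and u v :: real
  assume X: "X \<in> \<Theta>" and Y: "Y \<in> \<Theta>" and uv: "0 \<le> u" "0 \<le> v" "u + v = 1"
  have "sform (u *\<^sub>R X + v *\<^sub>R Y) w w \<in> \<real>\<^sub>\<ge>\<^sub>0" for w
    using correlation_form_nonneg[OF X, of w] correlation_form_nonneg[OF Y, of w] uv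
    by (simp add: sform_add sform_scaleR complex_nonneg_Reals_iff)
  moreover have "entry (u *\<^sub>R X + v *\<^sub>R Y) i i = 1" for i
    using uv by (simp add: correlation_diag[OF X] correlation_diag[OF Y] complex_eq_iff)
  ultimately show "u *\<^sub>R X + v *\<^sub>R Y \<in> \<Theta>"
    by (simp add: correlation_matrices_def pos_semidef_iff)
qed

lemma closed_correlations: "closed \<Theta>"
proof -
  have "closed {X :: complex^'n^'n. sform X v v \<in> \<real>\<^sub>\<ge>\<^sub>0}" for v
    unfolding sform_def complex_nonneg_Reals_iff
    by (intro closed_Collect_conj closed_Collect_le closed_Collect_eq continuous_intros)
  moreover have "closed {X :: complex^'n^'n. entry X i i = 1}" for i
    by (intro closed_Collect_eq continuous_intros)
  ultimately show ?thesis
    unfolding correlation_matrices_def pos_semidef_iff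
    by (intro closed_Collect_conj closed_Collect_all)
qed

lemma bounded_correlations: "bounded \<Theta>"
proof (rule boundedI)
  fix X :: "complex^'n^'n"
  assume X: "X \<in> \<Theta>"
  have "norm X \<le> (\<Sum>i\<in>UNIV. norm (vec_nth X i))"
    unfolding norm_vec_def by (rule L2_set_le_sum) simp
  also have "\<dots> \<le> (\<Sum>i\<in>UNIV. \<Sum>j\<in>UNIV. cmod (entry X i j))"
    unfolding norm_vec_def by (intro sum_mono L2_set_le_sum) simp
  also have "\<dots> \<le> (\<Sum>i\<in>(UNIV::'n set). \<Sum>j\<in>(UNIV::'n set). 1)"
    by (intro sum_mono correlation_entry_le_1[OF X])
  finally show "norm X \<le> (\<Sum>i\<in>(UNIV::'n set). \<Sum>j\<in>(UNIV::'n set). 1)" .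
qed

text \<open>By Minkowski's finite-dimensional form of Krein-Milman, a compact convex set is the hull
  of its extreme points without taking a closure.\<close>

lemma rank_one_hull_3: "(\<C> :: (complex^3^3) set) = \<Theta>"
  unfolding rank_one_hull_def extreme_points_correlation_3[symmetric]
  by (rule Krein_Milman_Minkowski[symmetric])
    (simp_all add: compact_eq_bounded_closed bounded_correlations closed_correlations
      convex_correlations)

section \<open>Unitary matrices\<close>

lemma sform_sum: "sform (\<Sum>a\<in>S. Y a) u v = (\<Sum>a\<in>S. sform (Y a) u v)"
proof (induction S rule: infinite_finite_induct)
  case (insert a S)
  then show ?case by (simp add: sform_add)
qed (simp_all add: sform_def)

lemma mat_adjoint_carrier: "V \<in> carrier_mat k k \<Longrightarrow> mat_adjoint V \<in> carrier_mat k k"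
  by (auto simp: mat_adjoint_def)

lemma mat_adjoint_mult_index:
  assumes "V \<in> carrier_mat k k" "W \<in> carrier_mat k k" "a < k" "b < k"
  shows "(mat_adjoint V * W) $$ (a, b) = (\<Sum>c<k. cnj (V $$ (c, a)) * W $$ (c, b))"
  using assms by (simp add: mat_adjoint_def scalar_prod_def mat_of_rows_row lessThan_atLeast0)

text \<open>Expanding the trace gives a positive multiple of a sum of outer products, one for each
  matrix position (c, a); each contributes a squared modulus to the form.\<close>

lemma unitary_matrices_correlation:
  fixes V :: "'n :: finite \<Rightarrow> complex mat"
  assumes "k \<ge> 1" and V: "\<And>i. V i \<in> unitary_group k"
  shows "(\<chi> i j. normalized_trace k (mat_adjoint (V i) * V j)) \<in> \<Theta>" (is "?X \<in> _")
proof -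
  have carr: "V i \<in> carrier_mat k k" and unit: "mat_adjoint (V i) * V i = 1\<^sub>m k" for i
    using V[of i] by (auto simp: unitary_group_def)
  \<comment> \<open>The double conjugation fits the shape a_i conj(b_j) of
    \<open>sform_outer\<close>.\<close>
  have "?X = (1 / k) *\<^sub>R (\<Sum>a<k. \<Sum>c<k.
      \<chi> i j. cnj (V i $$ (c, a)) * cnj (cnj (V j $$ (c, a))))"
    by (simp add: Finite_Cartesian_Product.vec_eq_iff normalized_trace_def mat_adjoint_mult_index[OF carr carr]
        scaleR_conv_of_real[where 'a = complex])
  then have "sform ?X v v = (1 / k) *\<^sub>R (\<Sum>a<k. \<Sum>c<k.
      sform (\<chi> i j. cnj (V i $$ (c, a)) * cnj (cnj (V j $$ (c, a)))) v v)" for v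
    by (simp only: sform_scaleR sform_sum)
  also have "\<dots> v = (1 / k) *\<^sub>R (\<Sum>a<k. \<Sum>c<k.
      complex_of_real ((cmod (\<Sum>j\<in>UNIV. V j $$ (c, a) * vec_nth v j))\<^sup>2))" for v
    unfolding sform_outer complex_norm_square by (simp add: mult.commute)
  finally have "sform ?X v v = complex_of_real ((1 / k) * (\<Sum>a<k. \<Sum>c<k.
      (cmod (\<Sum>j\<in>UNIV. V j $$ (c, a) * vec_nth v j))\<^sup>2))" for v
    by (simp add: scaleR_conv_of_real[where 'a = complex])
  then have "sform ?X v v \<in> \<real>\<^sub>\<ge>\<^sub>0" for v
    by (simp only: complex_nonneg_Reals_iff Re_complex_of_real Im_complex_of_real) (simp add: sum_nonneg)
  moreover have "normalized_trace k (mat_adjoint (V i) * V i) = 1" for i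
    using \<open>k \<ge> 1\<close> by (simp add: unit normalized_trace_def)
  ultimately show ?thesis
    by (simp add: correlation_matrices_def pos_semidef_iff)
qed

lemma matrix_unitary_correlations_subset: "\<F> \<subseteq> \<Theta>"
  unfolding matrix_unitary_correlations_def
  by (rule closure_minimal[OF _ closed_correlations]) (auto intro: unitary_matrices_correlation)

section \<open>Averages of phase matrices\<close>

definition phase_averages :: "(complex^'n^'n) set" where
  "phase_averages =
     {(1 / real k) *\<^sub>R (\<Sum>a<k. phase_matrix (x a)) | k x. k \<ge> 1 \<and> (\<forall>a i. cmod (x a i) = 1)}"

text \<open>The \<open>a\<close>-th diagonal entry of the diagonal unitary V_i is
  \<open>x a i\<close>. The normalized trace weighs all diagonal entries equally, which is why
  uniform averages are the ones considered.\<close>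

lemma phase_averages_unitary: "closure phase_averages \<subseteq> \<F>"
  unfolding matrix_unitary_correlations_def
proof (rule closure_mono, rule subsetI)
  fix X :: "complex^'n^'n"
  assume "X \<in> phase_averages"
  then obtain k x where k: "k \<ge> 1" and x: "\<And>a i. cmod (x a i) = 1"
    and X: "X = (1 / real k) *\<^sub>R (\<Sum>a<k. phase_matrix (x a))"
    by (auto simp: phase_averages_def)
  define V where "V i = mat k k (\<lambda>(a, b). if a = b then x a i else 0)" for i
  have carr: "V i \<in> carrier_mat k k" for i
    by (simp add: V_def)
  have index: "(mat_adjoint (V i) * V j) $$ (a, b) = (if a = b then cnj (x a i) * x a j else 0)"
    if "a < k" "b < k" for i j a b
  proof -
    have "(\<Sum>c<k. cnj (V i $$ (c, a)) * V j $$ (c, b)) =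
        (\<Sum>c<k. if c = a then (if a = b then cnj (x a i) * x a j else 0) else 0)"
      by (rule sum.cong) (auto simp: V_def that)
    then show ?thesis
      using that by (simp add: mat_adjoint_mult_index[OF carr carr])
  qed
  have "V i \<in> unitary_group k" for i
  proof -
    have "cnj (x a i) * x a i = 1" for a
      using x[of a i] by (simp only: unimodular_iff mult.commute)
    then have "mat_adjoint (V i) * V i = 1\<^sub>m k"
      using carr[of i] mat_adjoint_carrier[OF carr[of i]] by (intro eq_matI) (auto simp: index simp del: index_mult_mat(1))
    then show ?thesis
      using carr[of i] mat_mult_left_right_inverse[OF mat_adjoint_carrier[OF carr[of i]] carr[of i]]
      by (simp add: unitary_group_def)
  qed
  moreover have "X = (\<chi> i j. normalized_trace k (mat_adjoint (V i) * V j))"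
    by (simp add: X Finite_Cartesian_Product.vec_eq_iff normalized_trace_def index phase_matrix_def
        scaleR_conv_of_real[where 'a = complex])
  ultimately show "X \<in> {\<chi> i j. normalized_trace k (mat_adjoint (V i) * V j) |k V.
      k \<ge> 1 \<and> (\<forall>i. V i \<in> unitary_group k)}"
    using k by blast
qed

lemma sum_lessThan_add:
  fixes f :: "nat \<Rightarrow> 'b :: comm_monoid_add"
  shows "(\<Sum>a<m + n. f a) = (\<Sum>a<m. f a) + (\<Sum>a<n. f (m + a))"
  by (induction n) (simp_all add: add.assoc)

text \<open>Serves to lengthen an average by repeating each of its terms equally often.\<close>

lemma sum_mod_lessThan:
  fixes f :: "nat \<Rightarrow> 'b :: real_vector"
  shows "(\<Sum>a<n * k. f (a mod k)) = real n *\<^sub>R (\<Sum>a<k. f a)"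
proof (induction n)
  case (Suc n)
  have "(\<Sum>a<Suc n * k. f (a mod k)) = (\<Sum>a<n * k. f (a mod k)) + (\<Sum>a<k. f ((n * k + a) mod k))"
    unfolding mult_Suc add.commute[of k] by (rule sum_lessThan_add)
  also have "(\<Sum>a<k. f ((n * k + a) mod k)) = (\<Sum>a<k. f a)"
    by (rule sum.cong) auto
  finally have "(\<Sum>a<Suc n * k. f (a mod k)) = (\<Sum>a<n * k. f (a mod k)) + (\<Sum>a<k. f a)" .
  then show ?case
    unfolding Suc.IH by (simp only: of_nat_Suc scaleR_add_left scaleR_one add.commute)
qed simp

lemma phase_averages_midpoint:
  assumes "X \<in> phase_averages" "Y \<in> phase_averages"
  shows "midpoint X Y \<in> phase_averages"
proof -
  obtain k x where k: "k \<ge> 1" and x: "\<And>a i. cmod (x a i) = 1"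
    and X: "X = (1 / real k) *\<^sub>R (\<Sum>a<k. phase_matrix (x a))"
    using assms(1) by (auto simp: phase_averages_def)
  obtain l y where l: "l \<ge> 1" and y: "\<And>a i. cmod (y a i) = 1"
    and Y: "Y = (1 / real l) *\<^sub>R (\<Sum>a<l. phase_matrix (y a))"
    using assms(2) by (auto simp: phase_averages_def)
  \<comment> \<open>The first l*k terms repeat \<open>x\<close> \<open>l\<close> times and the last
    k*l repeat \<open>y\<close> \<open>k\<close> times, so both lists receive total weight
    1/2.\<close>
  define z where "z a = (if a < l * k then x (a mod k) else y ((a - l * k) mod l))" for a
  have "(\<Sum>a<l * k + k * l. phase_matrix (z a)) =
      (\<Sum>a<l * k. phase_matrix (x (a mod k))) + (\<Sum>a<k * l. phase_matrix (y (a mod l)))"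
    by (simp add: sum_lessThan_add z_def)
  also have "\<dots> = real l *\<^sub>R real k *\<^sub>R X + real k *\<^sub>R real l *\<^sub>R Y"
    using k l by (simp add: sum_mod_lessThan[of "\<lambda>a. phase_matrix (x a)"]
        sum_mod_lessThan[of "\<lambda>a. phase_matrix (y a)"] X Y)
  finally have "(1 / real (l * k + k * l)) *\<^sub>R (\<Sum>a<l * k + k * l. phase_matrix (z a)) = midpoint X Y"
    using k l by (simp add: midpoint_def scaleR_add_right divide_simps)
  moreover have "cmod (z a i) = 1" for a i
    by (simp add: z_def x y)
  moreover have "l * k + k * l \<ge> 1"
    using k l by (simp add: Suc_le_eq)
  ultimately show ?thesis
    unfolding phase_averages_def
    by (intro CollectI exI[of _ "l * k + k * l"] exI[of _ z] conjI allI) (simp_all only:)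
qed

text \<open>A point of the segment outside \<open>S\<close> would lie in a gap: by compactness there
  are a last parameter \<open>l\<close> before it and a first parameter \<open>r\<close> after it
  with values in \<open>S\<close>. The midpoint lies in \<open>S\<close> and strictly between them,
  a contradiction.\<close>

lemma closed_midpoint_convex:
  fixes S :: "'b :: real_normed_vector set"
  assumes "closed S" and mid: "\<And>x y. x \<in> S \<Longrightarrow> y \<in> S \<Longrightarrow> midpoint x y \<in> S"
  shows "convex S"
  unfolding convex_alt
proof (intro ballI allI impI)
  fix x y and u :: real
  assume x: "x \<in> S" and y: "y \<in> S" and u: "0 \<le> u \<and> u \<le> 1"
  define f where "f v = (1 - v) *\<^sub>R x + v *\<^sub>R y" for v
  have compact: "compact ({a..b} \<inter> f -` S)" for a b
  proof -
    have "continuous_on UNIV f"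
      unfolding f_def by (intro continuous_intros)
    then show ?thesis
      using \<open>closed S\<close> by (intro compact_Int_closed compact_Icc) (simp add: closed_vimage)
  qed
  have "f u \<in> S"
  proof (rule ccontr)
    assume "f u \<notin> S"
    have "0 \<in> {0..u} \<inter> f -` S"
      using u x by (simp add: f_def)
    then obtain l where l: "l \<in> {0..u} \<inter> f -` S" "\<And>t. t \<in> {0..u} \<inter> f -` S \<Longrightarrow> t \<le> l"
      using compact_attains_sup[OF compact] by (metis empty_iff)
    have "1 \<in> {u..1} \<inter> f -` S"
      using u y by (simp add: f_def)
    then obtain r where r: "r \<in> {u..1} \<inter> f -` S" "\<And>t. t \<in> {u..1} \<inter> f -` S \<Longrightarrow> r \<le> t"
      using compact_attains_inf[OF compact] by (metis empty_iff)
    have "f ((l + r) / 2) = midpoint (f l) (f r)"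
      by (simp add: f_def midpoint_def algebra_simps add_divide_distrib)
         (simp add: scaleR_add_left[symmetric] add_divide_distrib[symmetric])
    then have m: "f ((l + r) / 2) \<in> S"
      using mid l(1) r(1) by simp
    have "l < u" "u < r"
      using l(1) r(1) \<open>f u \<notin> S\<close> by (auto simp: less_le)
    show False
    proof (cases "(l + r) / 2 \<le> u")
      case True
      then show False
        using l(2)[of "(l + r) / 2"] m l(1) \<open>l < u\<close> \<open>u < r\<close> by auto
    next
      case False
      then show False
        using r(2)[of "(l + r) / 2"] m r(1) \<open>l < u\<close> \<open>u < r\<close> by auto
    qed
  qed
  then show "(1 - u) *\<^sub>R x + u *\<^sub>R y \<in> S"
    by (simp add: f_def)
qed

lemma convex_closure_phase_averages: "convex (closure phase_averages)"
proof (rule closed_midpoint_convex[OF closed_closure])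
  fix X Y :: "complex^'n^'n"
  assume "X \<in> closure phase_averages" "Y \<in> closure phase_averages"
  then obtain x y where x: "\<And>n. x n \<in> phase_averages" "x \<longlonglongrightarrow> X"
    and y: "\<And>n. y n \<in> phase_averages" "y \<longlonglongrightarrow> Y"
    unfolding closure_sequential by blast
  have "(\<lambda>n. midpoint (x n) (y n)) \<longlonglongrightarrow> midpoint X Y"
    unfolding midpoint_def by (intro tendsto_intros x y)
  moreover have "midpoint (x n) (y n) \<in> phase_averages" for n
    by (intro phase_averages_midpoint x y)
  ultimately show "midpoint X Y \<in> closure phase_averages"
    unfolding closure_sequential by (intro exI[of _ "\<lambda>n. midpoint (x n) (y n)"]) blast
qed

text \<open>A phase matrix is an average of length one, so the closed convex set of limits of
  averages contains the whole hull.\<close>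

lemma rank_one_hull_subset_matrix_unitary_correlations:
  "(\<C> :: (complex^'n^'n) set) \<subseteq> \<F>"
proof -
  have "phase_matrix x \<in> phase_averages" if "\<And>i. cmod (x i) = 1" for x :: "'n \<Rightarrow> complex"
    unfolding phase_averages_def
    by (rule CollectI, rule exI[of _ 1], rule exI[of _ "\<lambda>_. x"]) (simp add: that)
  then have "{X \<in> \<Theta>. rank X = 1} \<subseteq> closure (phase_averages :: (complex^'n^'n) set)"
    unfolding rank_one_correlations using closure_subset by fast
  then have "\<C> \<subseteq> closure (phase_averages :: (complex^'n^'n) set)"
    unfolding rank_one_hull_def by (rule hull_minimal) (rule convex_closure_phase_averages)
  then show ?thesis
    using phase_averages_unitary by blast
qed

section \<open>Tracial states\<close>

text \<open>\<open>y\<close> is the sum of the c_i U_i, built by induction. Its pairings with every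
  \<open>z\<close> on either side are what expands \<tau>(y^* y) into the form of the correlation
  matrix.\<close>

lemma (in faithful_tracial_state) linear_combination_correlations:
  assumes "finite S" and U: "\<And>i. U i \<in> carrier A"
  shows "\<exists>y\<in>carrier A. \<forall>z\<in>carrier A.
    \<tau> (adj A z \<otimes> y) = (\<Sum>i\<in>S. c i * \<tau> (adj A z \<otimes> U i)) \<and>
    \<tau> (adj A y \<otimes> z) = (\<Sum>i\<in>S. cnj (c i) * \<tau> (adj A (U i) \<otimes> z))"
  using \<open>finite S\<close>
proof induction
  case empty
  \<comment> \<open>Neither \<tau>(0) = 0 nor 0^* = 0 is an axiom; both follow from homogeneity with
    scalar 0.\<close>
  have zero: "(0 :: complex) \<odot> x = \<zero>" if "x \<in> carrier A" for x
    using smult_l_null[of x] that by simp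
  have "\<tau> \<zero> = 0"
    using state_smult[of \<zero> 0] by (simp add: zero)
  moreover have "adj A \<zero> = \<zero>"
    using adj_smult[of \<zero> 0] by (simp add: zero adj_closed)
  ultimately have "\<tau> (adj A z \<otimes> \<zero>) = 0 \<and> \<tau> (adj A \<zero> \<otimes> z) = 0" if "z \<in> carrier A" for z
    using that by (simp add: adj_closed)
  then show ?case by auto
next
  case (insert i S)
  then obtain y where y: "y \<in> carrier A"
    and eq: "\<And>z. z \<in> carrier A \<Longrightarrow> \<tau> (adj A z \<otimes> y) = (\<Sum>i\<in>S. c i * \<tau> (adj A z \<otimes> U i))"
      "\<And>z. z \<in> carrier A \<Longrightarrow> \<tau> (adj A y \<otimes> z) = (\<Sum>i\<in>S. cnj (c i) * \<tau> (adj A (U i) \<otimes> z))"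
    by blast
  show ?case
  proof (intro bexI[of _ "y \<oplus> c i \<odot> U i"] ballI)
    fix z assume z: "z \<in> carrier A"
    show "\<tau> (adj A z \<otimes> (y \<oplus> c i \<odot> U i)) = (\<Sum>i\<in>insert i S. c i * \<tau> (adj A z \<otimes> U i)) \<and>
        \<tau> (adj A (y \<oplus> c i \<odot> U i) \<otimes> z) = (\<Sum>i\<in>insert i S. cnj (c i) * \<tau> (adj A (U i) \<otimes> z))"
      using insert.hyps y z U
      by (simp add: adj_closed adj_add adj_smult l_distr r_distr smult_mult_left smult_mult_right
          state_add state_smult eq)
  qed (use y U in simp)
qed

lemma tracial_unitary_correlationsI:
  fixes A :: "'a cstar"
  assumes "faithful_tracial_state A \<tau>" "\<And>i. U i \<in> unitaries A"
  shows "(\<chi> i j. \<tau> (adj A (U i) \<otimes>\<^bsub>A\<^esub> U j)) \<in> \<G> TYPE('a)"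
  unfolding tracial_unitary_correlations_def using assms by blast

text \<open>A Gram matrix argument: with \<open>y\<close> the combination of the U_j with
  coefficients v_j, the form at \<open>v\<close> is \<tau>(y^* y). Unitarity makes each diagonal
  entry \<tau>(1).\<close>

lemma tracial_unitary_correlations_subset:
  "(\<G> TYPE('a) :: (complex^'n^'n) set) \<subseteq> \<Theta>"
proof
  fix X :: "complex^'n^'n"
  assume "X \<in> \<G> TYPE('a)"
  then obtain A :: "'a cstar" and \<tau> U where "faithful_tracial_state A \<tau>"
    and U: "\<And>i. U i \<in> unitaries A"
    and X: "X = (\<chi> i j. \<tau> (adj A (U i) \<otimes>\<^bsub>A\<^esub> U j))"
    unfolding tracial_unitary_correlations_def by blast
  interpret faithful_tracial_state A \<tau> by fact
  have carr: "U i \<in> carrier A" and unit: "adj A (U i) \<otimes>\<^bsub>A\<^esub> U i = \<one>\<^bsub>A\<^esub>" for i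
    using U[of i] by (auto simp: unitaries_def)
  have "sform X v v \<in> \<real>\<^sub>\<ge>\<^sub>0" for v
  proof -
    obtain y where y: "y \<in> carrier A"
      and left: "\<And>z. z \<in> carrier A \<Longrightarrow>
        \<tau> (adj A z \<otimes>\<^bsub>A\<^esub> y) = (\<Sum>j\<in>UNIV. vec_nth v j * \<tau> (adj A z \<otimes>\<^bsub>A\<^esub> U j))"
      and right: "\<And>z. z \<in> carrier A \<Longrightarrow>
        \<tau> (adj A y \<otimes>\<^bsub>A\<^esub> z) = (\<Sum>i\<in>UNIV. cnj (vec_nth v i) * \<tau> (adj A (U i) \<otimes>\<^bsub>A\<^esub> z))"
      using linear_combination_correlations[of UNIV U "vec_nth v", OF finite carr] by blast
    have "sform X v v = \<tau> (adj A y \<otimes>\<^bsub>A\<^esub> y)"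
      by (simp add: sform_def X left[OF carr] right[OF y] sum_distrib_left mult_ac)
    then show ?thesis
      using state_positive[OF y] by simp
  qed
  then show "X \<in> \<Theta>"
    by (simp add: correlation_matrices_def pos_semidef_iff X unit state_one)
qed

subsection \<open>Transport along injections\<close>

text \<open>Each operation decodes by \<open>d\<close>, acts in \<open>A\<close> and encodes by
  \<open>e\<close>. When \<open>e\<close> is injective on the carrier, this is an isomorphic copy of
  \<open>A\<close> in another universe.\<close>

definition transport_cstar :: "('a \<Rightarrow> 'b) \<Rightarrow> 'a cstar \<Rightarrow> 'b cstar" where
  "transport_cstar e A = (let d = inv_into (carrier A) e in
     \<lparr>carrier = e ` carrier A,
      mult = \<lambda>x y. e (d x \<otimes>\<^bsub>A\<^esub> d y),
      one = e \<one>\<^bsub>A\<^esub>,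
      zero = e \<zero>\<^bsub>A\<^esub>,
      add = \<lambda>x y. e (d x \<oplus>\<^bsub>A\<^esub> d y),
      smult = \<lambda>c x. e (c \<odot>\<^bsub>A\<^esub> d x),
      adj = \<lambda>x. e (adj A (d x)),
      nrm = \<lambda>x. nrm A (d x)\<rparr>)"

locale cstar_transport = faithful_tracial_state A \<tau>
  for A :: "'a cstar" (structure) and \<tau> +
  fixes e :: "'a \<Rightarrow> 'b"
  assumes inj: "inj_on e (carrier A)"
begin

abbreviation B :: "'b cstar" where "B \<equiv> transport_cstar e A"

lemma carrier_transport: "carrier B = e ` carrier A"
  by (simp add: transport_cstar_def Let_def)

lemma transport_simps:
  "x \<in> carrier A \<Longrightarrow> y \<in> carrier A \<Longrightarrow> e x \<otimes>\<^bsub>B\<^esub> e y = e (x \<otimes> y)"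
  "\<one>\<^bsub>B\<^esub> = e \<one>"
  "\<zero>\<^bsub>B\<^esub> = e \<zero>"
  "x \<in> carrier A \<Longrightarrow> y \<in> carrier A \<Longrightarrow> e x \<oplus>\<^bsub>B\<^esub> e y = e (x \<oplus> y)"
  "x \<in> carrier A \<Longrightarrow> c \<odot>\<^bsub>B\<^esub> e x = e (c \<odot> x)"
  "x \<in> carrier A \<Longrightarrow> adj B (e x) = e (adj A x)"
  "x \<in> carrier A \<Longrightarrow> nrm B (e x) = nrm A x"
  using inj by (simp_all add: transport_cstar_def Let_def)

lemma e_eq_iff: "x \<in> carrier A \<Longrightarrow> y \<in> carrier A \<Longrightarrow> e x = e y \<longleftrightarrow> x = y"
  using inj by (auto dest: inj_onD)

lemma ring_transport: "ring B"
proof (rule ringI)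
  show "abelian_group B"
  proof (rule abelian_groupI)
    fix x assume "x \<in> carrier B"
    then obtain x' where "x = e x'" "x' \<in> carrier A"
      by (auto simp: carrier_transport)
    then show "\<exists>y\<in>carrier B. y \<oplus>\<^bsub>B\<^esub> x = \<zero>\<^bsub>B\<^esub>"
      by (auto simp: carrier_transport transport_simps l_neg intro!: bexI[of _ "\<ominus> x'"])
  qed (auto simp: carrier_transport transport_simps a_assoc
      intro: arg_cong[of _ _ e, OF a_comm])
  show "monoid B"
    by (rule monoidI) (auto simp: carrier_transport transport_simps m_assoc)
qed (auto simp: carrier_transport transport_simps l_distr r_distr)

lemma module_transport: "module (class_ring :: complex ring) B"
proof (rule moduleI)
  show "cring (class_ring :: complex ring)"
    by (rule class_cring.is_cring)
  show "abelian_group B"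
    by (rule ring.is_abelian_group[OF ring_transport])
qed (auto simp: carrier_transport transport_simps smult_l_distr[simplified] smult_r_distr
    smult_assoc1[simplified] smult_one[simplified])

lemma minus_transport:
  assumes "x \<in> carrier A" "y \<in> carrier A"
  shows "e x \<ominus>\<^bsub>B\<^esub> e y = e (x \<ominus> y)"
proof -
  interpret B: ring B by (rule ring_transport)
  have "\<ominus>\<^bsub>B\<^esub> e y = e (\<ominus> y)"
    by (rule B.minus_equality) (auto simp: assms carrier_transport transport_simps l_neg)
  then show ?thesis
    by (simp add: assms a_minus_def transport_simps)
qed

lemma faithful_tracial_state_transport:
  "faithful_tracial_state B (\<lambda>x. \<tau> (inv_into (carrier A) e x))"
proof (intro faithful_tracial_state.intro unital_cstar_algebra.intro
    unital_cstar_algebra_axioms.intro faithful_tracial_state_axioms.intro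
    module_transport ring_transport)
  fix \<sigma> :: "nat \<Rightarrow> 'b"
  assume \<sigma>: "\<And>n. \<sigma> n \<in> carrier B"
    and Cauchy: "\<And>\<epsilon>. \<epsilon> > 0 \<Longrightarrow> \<exists>N. \<forall>m\<ge>N. \<forall>n\<ge>N. nrm B (\<sigma> m \<ominus>\<^bsub>B\<^esub> \<sigma> n) < \<epsilon>"
  \<comment> \<open>Completeness is inherited by decoding: \<rho> is Cauchy in \<open>A\<close>, and
    encoding preserves norms of differences.\<close>
  obtain \<rho> where \<rho>: "\<And>n. \<rho> n \<in> carrier A" "\<And>n. \<sigma> n = e (\<rho> n)"
    using \<sigma> unfolding carrier_transport image_iff by metis
  have nrm: "nrm B (e x \<ominus>\<^bsub>B\<^esub> e y) = nrm A (x \<ominus> y)" if "x \<in> carrier A" "y \<in> carrier A" for x y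
    using that by (simp add: minus_transport transport_simps)
  have "\<exists>x\<in>carrier A. (\<lambda>n. nrm A (\<rho> n \<ominus> x)) \<longlonglongrightarrow> 0"
    using Cauchy by (intro complete) (auto simp: \<rho> nrm)
  then show "\<exists>x\<in>carrier B. (\<lambda>n. nrm B (\<sigma> n \<ominus>\<^bsub>B\<^esub> x)) \<longlonglongrightarrow> 0"
    by (auto simp: carrier_transport \<rho> nrm)
qed (auto simp: carrier_transport transport_simps inj e_eq_iff adj_closed smult_mult_left
    smult_mult_right nrm_nonneg nrm_eq_0 nrm_triangle nrm_smult nrm_mult adj_adj adj_add adj_smult
    adj_mult cstar_identity state_add state_smult state_positive state_one
    intro: tracial faithful)

end

text \<open>The algebra, its trace and the unitaries move to the isomorphic copy, and the
  correlations, being numbers, stay the same.\<close>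

lemma tracial_unitary_correlations_mono:
  assumes "(UNIV :: 'a set) \<lesssim> (UNIV :: 'b set)"
  shows "(\<G> TYPE('a) :: (complex^'n^'n) set) \<subseteq> \<G> TYPE('b)"
proof
  fix X :: "complex^'n^'n"
  assume "X \<in> \<G> TYPE('a)"
  then obtain A :: "'a cstar" and \<tau> U where state: "faithful_tracial_state A \<tau>"
    and U: "\<And>i. U i \<in> unitaries A"
    and X: "X = (\<chi> i j. \<tau> (adj A (U i) \<otimes>\<^bsub>A\<^esub> U j))"
    unfolding tracial_unitary_correlations_def by blast
  obtain e :: "'a \<Rightarrow> 'b" where "inj e"
    using assms by (auto simp: lepoll_def)
  then interpret cstar_transport A \<tau> e
    using state by (intro cstar_transport.intro cstar_transport_axioms.intro)
      (auto intro: inj_on_subset)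
  have carr: "U i \<in> carrier A" for i
    using U[of i] by (simp add: unitaries_def)
  have "e (U i) \<in> unitaries B" for i
    using U[of i] by (simp add: unitaries_def carrier_transport transport_simps adj_closed)
  moreover have "X = (\<chi> i j. \<tau> (inv_into (carrier A) e (adj B (e (U i)) \<otimes>\<^bsub>B\<^esub> e (U j))))"
    by (simp add: X transport_simps carr adj_closed inj)
  ultimately show "X \<in> \<G> TYPE('b)"
    using tracial_unitary_correlationsI[OF faithful_tracial_state_transport, of "\<lambda>i. e (U i)"]
    by (simp only:)
qed

subsection \<open>Functions on a finite set\<close>

text \<open>Extension by zero lets index sets of all sizes share one type. The inserted 0 gives the
  maximum norm a value for empty \<open>I\<close> too.\<close>

definition fun_cstar :: "'i set \<Rightarrow> ('i \<Rightarrow> complex) cstar" where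
  "fun_cstar I =
     \<lparr>carrier = {f. \<forall>i. i \<notin> I \<longrightarrow> f i = 0},
      mult = \<lambda>f g i. f i * g i,
      one = \<lambda>i. of_bool (i \<in> I),
      zero = \<lambda>i. 0,
      add = \<lambda>f g i. f i + g i,
      smult = \<lambda>c f i. c * f i,
      adj = \<lambda>f i. cnj (f i),
      nrm = \<lambda>f. Max (insert 0 ((\<lambda>i. cmod (f i)) ` I))\<rparr>"

lemma fun_cstar_simps [simp]:
  "f \<in> carrier (fun_cstar I) \<longleftrightarrow> (\<forall>i. i \<notin> I \<longrightarrow> f i = 0)"
  "f \<otimes>\<^bsub>fun_cstar I\<^esub> g = (\<lambda>i. f i * g i)"
  "\<one>\<^bsub>fun_cstar I\<^esub> = (\<lambda>i. of_bool (i \<in> I))"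
  "\<zero>\<^bsub>fun_cstar I\<^esub> = (\<lambda>i. 0)"
  "f \<oplus>\<^bsub>fun_cstar I\<^esub> g = (\<lambda>i. f i + g i)"
  "c \<odot>\<^bsub>fun_cstar I\<^esub> f = (\<lambda>i. c * f i)"
  "adj (fun_cstar I) f = (\<lambda>i. cnj (f i))"
  by (simp_all add: fun_cstar_def)

text \<open>Through this characterization by upper bounds, the norm inequalities below reduce to
  pointwise ones.\<close>

lemma nrm_fun_cstar_le_iff:
  "finite I \<Longrightarrow> nrm (fun_cstar I) f \<le> b \<longleftrightarrow> 0 \<le> b \<and> (\<forall>i\<in>I. cmod (f i) \<le> b)"
  by (simp add: fun_cstar_def)

lemma norm_le_nrm_fun_cstar: "finite I \<Longrightarrow> i \<in> I \<Longrightarrow> cmod (f i) \<le> nrm (fun_cstar I) f"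
  and nrm_fun_cstar_nonneg: "finite I \<Longrightarrow> 0 \<le> nrm (fun_cstar I) f"
  using nrm_fun_cstar_le_iff[of I f "nrm (fun_cstar I) f"] by auto

lemma ring_fun_cstar: "ring (fun_cstar I)"
proof (rule ringI)
  show "abelian_group (fun_cstar I)"
  proof (rule abelian_groupI)
    fix f assume "f \<in> carrier (fun_cstar I)"
    then show "\<exists>g\<in>carrier (fun_cstar I). g \<oplus>\<^bsub>fun_cstar I\<^esub> f = \<zero>\<^bsub>fun_cstar I\<^esub>"
      by (intro bexI[of _ "\<lambda>i. - f i"]) auto
  qed (auto simp: fun_eq_iff)
  show "monoid (fun_cstar I)"
    by (rule monoidI) (auto simp: fun_eq_iff)
qed (auto simp: fun_eq_iff algebra_simps)

lemma module_fun_cstar: "module (class_ring :: complex ring) (fun_cstar I)"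
proof (rule moduleI)
  show "cring (class_ring :: complex ring)"
    by (rule class_cring.is_cring)
  show "abelian_group (fun_cstar I)"
    by (rule ring.is_abelian_group[OF ring_fun_cstar])
qed (auto simp: fun_eq_iff algebra_simps)

lemma minus_fun_cstar:
  assumes "f \<in> carrier (fun_cstar I)" "g \<in> carrier (fun_cstar I)"
  shows "f \<ominus>\<^bsub>fun_cstar I\<^esub> g = (\<lambda>i. f i - g i)"
proof -
  interpret ring "fun_cstar I" by (rule ring_fun_cstar)
  have "\<ominus>\<^bsub>fun_cstar I\<^esub> g = (\<lambda>i. - g i)"
    by (rule minus_equality) (use assms in auto)
  then show ?thesis
    by (simp add: a_minus_def)
qed

lemma unital_cstar_algebra_fun_cstar:
  assumes I: "finite I"
  shows "unital_cstar_algebra (fun_cstar I)"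
proof (intro unital_cstar_algebra.intro unital_cstar_algebra_axioms.intro
    module_fun_cstar ring_fun_cstar)
  let ?nrm = "nrm (fun_cstar I)"
  note le_nrm = norm_le_nrm_fun_cstar[OF I] and nrm_nonneg = nrm_fun_cstar_nonneg[OF I]
    and nrm_le = nrm_fun_cstar_le_iff[OF I]
  fix f g and c :: complex
  show "0 \<le> ?nrm f"
    by (rule nrm_nonneg)
  show "?nrm f = 0 \<longleftrightarrow> f = \<zero>\<^bsub>fun_cstar I\<^esub>" if "f \<in> carrier (fun_cstar I)"
    using that nrm_nonneg[of f] nrm_le[of f 0] by (auto simp: fun_eq_iff order.antisym)
  show "?nrm (f \<oplus>\<^bsub>fun_cstar I\<^esub> g) \<le> ?nrm f + ?nrm g"
    unfolding nrm_le by (auto intro!: add_nonneg_nonneg nrm_nonneg norm_triangle_le add_mono le_nrm)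
  show "?nrm (f \<otimes>\<^bsub>fun_cstar I\<^esub> g) \<le> ?nrm f * ?nrm g"
    unfolding nrm_le by (auto intro!: mult_nonneg_nonneg nrm_nonneg mult_mono le_nrm simp: norm_mult)
  show "?nrm (c \<odot>\<^bsub>fun_cstar I\<^esub> f) = cmod c * ?nrm f"
  proof (rule order.antisym)
    show "?nrm (c \<odot>\<^bsub>fun_cstar I\<^esub> f) \<le> cmod c * ?nrm f"
      unfolding nrm_le by (auto intro!: mult_nonneg_nonneg nrm_nonneg mult_left_mono le_nrm simp: norm_mult)
    show "cmod c * ?nrm f \<le> ?nrm (c \<odot>\<^bsub>fun_cstar I\<^esub> f)"
    proof (cases "c = 0")
      case False
      have "?nrm f \<le> ?nrm (c \<odot>\<^bsub>fun_cstar I\<^esub> f) / cmod c"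
        unfolding nrm_le using le_nrm[of _ "\<lambda>i. c * f i"] nrm_nonneg False
        by (auto simp: pos_le_divide_eq norm_mult mult.commute)
      then show ?thesis
        using False by (simp add: pos_le_divide_eq mult.commute)
    qed (use nrm_nonneg in simp)
  qed
  show "?nrm (adj (fun_cstar I) f \<otimes>\<^bsub>fun_cstar I\<^esub> f) = (?nrm f)\<^sup>2"
  proof (rule order.antisym)
    show "?nrm (adj (fun_cstar I) f \<otimes>\<^bsub>fun_cstar I\<^esub> f) \<le> (?nrm f)\<^sup>2"
      unfolding nrm_le power2_eq_square
      by (auto intro!: mult_mono le_nrm nrm_nonneg simp: norm_mult)
    \<comment> \<open>Taking the root first leaves a pointwise claim: |f i|^2 is at most the norm of
      f^* f.\<close>
    have "?nrm f \<le> sqrt (?nrm (adj (fun_cstar I) f \<otimes>\<^bsub>fun_cstar I\<^esub> f))"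
      unfolding nrm_le using le_nrm[of _ "\<lambda>i. cnj (f i) * f i"] nrm_nonneg
      by (auto intro!: real_le_rsqrt simp: norm_mult power2_eq_square)
    then show "(?nrm f)\<^sup>2 \<le> ?nrm (adj (fun_cstar I) f \<otimes>\<^bsub>fun_cstar I\<^esub> f)"
      using nrm_nonneg by (metis power_mono real_sqrt_pow2)
  qed
next
  fix \<sigma> :: "nat \<Rightarrow> 'a \<Rightarrow> complex"
  assume \<sigma>: "\<And>n. \<sigma> n \<in> carrier (fun_cstar I)"
    and Cauchy: "\<And>\<epsilon>. \<epsilon> > 0 \<Longrightarrow>
      \<exists>N. \<forall>m\<ge>N. \<forall>n\<ge>N. nrm (fun_cstar I) (\<sigma> m \<ominus>\<^bsub>fun_cstar I\<^esub> \<sigma> n) < \<epsilon>"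
  have "convergent (\<lambda>n. \<sigma> n i)" if "i \<in> I" for i
  proof (rule Cauchy_convergent, rule metric_CauchyI)
    fix \<epsilon> :: real assume "\<epsilon> > 0"
    then obtain N where N: "\<And>m n. m \<ge> N \<Longrightarrow> n \<ge> N \<Longrightarrow>
        nrm (fun_cstar I) (\<sigma> m \<ominus>\<^bsub>fun_cstar I\<^esub> \<sigma> n) < \<epsilon>"
      using Cauchy by blast
    have "dist (\<sigma> m i) (\<sigma> n i) < \<epsilon>" if "m \<ge> N" "n \<ge> N" for m n
      using norm_le_nrm_fun_cstar[OF I \<open>i \<in> I\<close>, of "\<lambda>i. \<sigma> m i - \<sigma> n i"] N[OF that]
      by (simp add: minus_fun_cstar[OF \<sigma> \<sigma>] dist_norm)
    then show "\<exists>N. \<forall>m\<ge>N. \<forall>n\<ge>N. dist (\<sigma> m i) (\<sigma> n i) < \<epsilon>"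
      by blast
  qed
  then obtain l where l: "\<And>i. i \<in> I \<Longrightarrow> (\<lambda>n. \<sigma> n i) \<longlonglongrightarrow> l i"
    unfolding convergent_def by metis
  define x where "x i = (if i \<in> I then l i else 0)" for i
  have x: "x \<in> carrier (fun_cstar I)"
    by (simp add: x_def)
  \<comment> \<open>As \<open>I\<close> is finite, pointwise limits suffice: the maximum norm is
    squeezed below this sum.\<close>
  have lim: "(\<lambda>n. \<Sum>i\<in>I. cmod (\<sigma> n i - x i)) \<longlonglongrightarrow> 0"
    using l by (intro tendsto_null_sum tendsto_norm_zero) (simp add: LIM_zero_iff x_def)
  have "nrm (fun_cstar I) (\<lambda>i. \<sigma> n i - x i) \<le> (\<Sum>i\<in>I. cmod (\<sigma> n i - x i))" for n
    unfolding nrm_fun_cstar_le_iff[OF I] using I by (auto intro: sum_nonneg member_le_sum)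
  then have "(\<lambda>n. nrm (fun_cstar I) (\<lambda>i. \<sigma> n i - x i)) \<longlonglongrightarrow> 0"
    by (intro tendsto_sandwich[OF _ _ tendsto_const lim]) (simp_all add: nrm_fun_cstar_nonneg[OF I])
  then show "\<exists>x\<in>carrier (fun_cstar I).
      (\<lambda>n. nrm (fun_cstar I) (\<sigma> n \<ominus>\<^bsub>fun_cstar I\<^esub> x)) \<longlonglongrightarrow> 0"
    using x by (intro bexI[of _ x]) (simp_all only: minus_fun_cstar[OF \<sigma> x])
qed (auto simp: fun_eq_iff)

text \<open>The value at f^* f is the sum of the u_i |f_i|^2, so strictly positive weights give
  faithfulness. The trace property is commutativity of pointwise multiplication.\<close>

lemma faithful_tracial_state_fun_cstar:
  fixes u :: "'i \<Rightarrow> real"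
  assumes I: "finite I" and u: "\<And>i. i \<in> I \<Longrightarrow> u i > 0" "sum u I = 1"
  shows "faithful_tracial_state (fun_cstar I) (\<lambda>f. \<Sum>i\<in>I. u i * f i)"
proof (intro faithful_tracial_state.intro faithful_tracial_state_axioms.intro
    unital_cstar_algebra_fun_cstar I)
  fix f assume f: "f \<in> carrier (fun_cstar I)"
  have "u i * (adj (fun_cstar I) f \<otimes>\<^bsub>fun_cstar I\<^esub> f) i = complex_of_real (u i * (cmod (f i))\<^sup>2)" for i
    unfolding of_real_mult complex_norm_square by simp
  then have eq: "(\<Sum>i\<in>I. u i * (adj (fun_cstar I) f \<otimes>\<^bsub>fun_cstar I\<^esub> f) i) =
      complex_of_real (\<Sum>i\<in>I. u i * (cmod (f i))\<^sup>2)"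
    by (simp only: of_real_sum)
  have nonneg: "0 \<le> u i * (cmod (f i))\<^sup>2" if "i \<in> I" for i
    using u(1)[OF that] by simp
  show "(\<Sum>i\<in>I. u i * (adj (fun_cstar I) f \<otimes>\<^bsub>fun_cstar I\<^esub> f) i) \<in> \<real>\<^sub>\<ge>\<^sub>0"
    unfolding eq complex_nonneg_Reals_iff Re_complex_of_real Im_complex_of_real
    by (intro conjI sum_nonneg nonneg refl)
  assume "(\<Sum>i\<in>I. u i * (adj (fun_cstar I) f \<otimes>\<^bsub>fun_cstar I\<^esub> f) i) = 0"
  then have "(\<Sum>i\<in>I. u i * (cmod (f i))\<^sup>2) = 0"
    unfolding eq of_real_eq_0_iff .
  then have "\<forall>i\<in>I. u i * (cmod (f i))\<^sup>2 = 0"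
    by (subst (asm) sum_nonneg_eq_0_iff[OF I nonneg])
  then have "\<forall>i\<in>I. f i = 0"
    using u(1) by fastforce
  then show "f = \<zero>\<^bsub>fun_cstar I\<^esub>"
    using f by (auto simp: fun_eq_iff)
next
  show "(\<Sum>i\<in>I. u i * \<one>\<^bsub>fun_cstar I\<^esub> i) = (1 :: complex)"
    using u(2) by (simp flip: of_real_sum)
qed (simp_all add: sum.distrib sum_distrib_left algebra_simps)

text \<open>The terms of a convex combination are indexed by naturals, so functions on these indices
  realize it inside one fixed universe, with the weights defining the trace.\<close>

lemma rank_one_hull_subset_tracial_unitary_correlations:
  "(\<C> :: (complex^'n^'n) set) \<subseteq> \<G> TYPE(nat \<Rightarrow> complex)"
proof
  fix X :: "complex^'n^'n"
  assume "X \<in> \<C>"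
  then obtain N u p where u: "\<And>a. a \<in> {1..N} \<Longrightarrow> 0 \<le> u a" "sum u {1..N} = 1"
    and p: "\<And>a. a \<in> {1..N} \<Longrightarrow> p a \<in> phase_matrix ` {x. \<forall>i. cmod (x i) = 1}"
    and X: "X = (\<Sum>a\<in>{1..N::nat}. u a *\<^sub>R p a)"
    unfolding rank_one_hull_def convex_hull_indexed rank_one_correlations by blast
  obtain x where x: "\<And>a i. a \<in> {1..N} \<Longrightarrow> cmod (x a i) = 1"
    and p_eq: "\<And>a. a \<in> {1..N} \<Longrightarrow> p a = phase_matrix (x a)"
    using p unfolding image_iff mem_Collect_eq Bex_def by metis
  \<comment> \<open>Terms of weight zero are dropped because faithfulness requires strictly positive
    weights.\<close>
  define I where "I = {a \<in> {1..N}. u a > 0}"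
  have "sum u I = sum u {1..N}"
    unfolding I_def using u(1) by (intro sum.mono_neutral_left) (auto simp: less_le)
  then have state: "faithful_tracial_state (fun_cstar I) (\<lambda>f. \<Sum>a\<in>I. u a * f a)"
    using u(2) by (intro faithful_tracial_state_fun_cstar) (auto simp: I_def)
  \<comment> \<open>U_i collects the \<open>i\<close>-th phases of all the rank one matrices; it is
    unitary because they are unimodular on \<open>I\<close>.\<close>
  define U where "U i a = (if a \<in> I then x a i else 0)" for i a
  have "cnj (x a i) * x a i = 1" "x a i * cnj (x a i) = 1" if "a \<in> I" for a i
    using x[of a i] that by (simp_all only: unimodular_iff mult.commute I_def mem_Collect_eq)
  then have "U i \<in> unitaries (fun_cstar I)" for i
    by (auto simp: unitaries_def U_def fun_eq_iff)
  moreover have "X = (\<chi> i j. \<Sum>a\<in>I. u a * (adj (fun_cstar I) (U i) \<otimes>\<^bsub>fun_cstar I\<^esub> U j) a)"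
  proof -
    have "X = (\<Sum>a\<in>I. u a *\<^sub>R p a)"
      unfolding X I_def using u(1) by (intro sum.mono_neutral_right) (auto simp: less_le)
    also have "\<dots> = (\<Sum>a\<in>I. u a *\<^sub>R phase_matrix (x a))"
      by (intro sum.cong) (auto simp: I_def p_eq)
    finally show ?thesis
      by (simp add: Finite_Cartesian_Product.vec_eq_iff phase_matrix_def U_def
          scaleR_conv_of_real[where 'a = complex])
  qed
  ultimately show "X \<in> \<G> TYPE(nat \<Rightarrow> complex)"
    using tracial_unitary_correlationsI[OF state, of U] by (simp only:)
qed

section \<open>Size of the universe and conclusion\<close>

lemma complex_sequences_lepoll_reals: "(UNIV :: (nat \<Rightarrow> complex) set) \<lesssim> (UNIV :: real set)"
proof -
  obtain r :: "real \<Rightarrow> nat set" where "inj r"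
    using eqpoll_imp_lepoll[OF eqpoll_sym[OF nat_sets_eqpoll_reals]] by (auto simp: lepoll_def)
  \<comment> \<open>\<open>r\<close> codes a real as a set of naturals. A sequence becomes the pairs
    (n, m) with \<open>m\<close> in the code of its \<open>n\<close>-th real part, joined disjointly
    with those of the imaginary parts; \<open>sum_encode\<close> makes this one set of
    naturals.\<close>
  define code where
    "code f = {prod_encode (n, m) | n m. m \<in> r (Re (f n))}
      <+> {prod_encode (n, m) | n m. m \<in> r (Im (f n))}" for f :: "nat \<Rightarrow> complex"
  have "inj (\<lambda>f. sum_encode ` code f)"
  proof (rule injI)
    fix f g
    assume "sum_encode ` code f = sum_encode ` code g"
    then have "code f = code g"
      by (simp add: inj_image_eq_iff inj_sum_encode)
    have mem: "m \<in> r (Re (h n)) \<longleftrightarrow> Inl (prod_encode (n, m)) \<in> code h"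
      "m \<in> r (Im (h n)) \<longleftrightarrow> Inr (prod_encode (n, m)) \<in> code h" for h n m
      by (auto simp: code_def)
    have "r (Re (f n)) = r (Re (g n))" "r (Im (f n)) = r (Im (g n))" for n
      using \<open>code f = code g\<close> by (auto simp: mem)
    then show "f = g"
      using injD[OF \<open>inj r\<close>] by (intro ext complex_eqI) blast+
  qed
  then have "(UNIV :: (nat \<Rightarrow> complex) set) \<lesssim> (UNIV :: nat set set)"
    unfolding lepoll_def by blast
  then show ?thesis
    by (rule lepoll_trans2[OF _ nat_sets_eqpoll_reals])
qed

theorem corollary2p8:
  assumes "(UNIV :: real set) \<lesssim> (UNIV :: 'a set)"
  shows "{X. X extreme_point_of (\<Theta> :: (complex^3^3) set)} = {X \<in> \<Theta>. rank X = 1}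
    \<and> (\<C> :: (complex^3^3) set) = \<F>
    \<and> (\<F> :: (complex^3^3) set) = \<G> TYPE('a)
    \<and> (\<G> TYPE('a) :: (complex^3^3) set) = \<Theta>"
proof -
  have "\<F> = (\<Theta> :: (complex^3^3) set)"
    using matrix_unitary_correlations_subset rank_one_hull_subset_matrix_unitary_correlations
      rank_one_hull_3 by blast
  \<comment> \<open>The universe of the function algebras is no larger than the reals, hence injects
    into the given type.\<close>
  moreover have "\<G> TYPE(nat \<Rightarrow> complex) \<subseteq> (\<G> TYPE('a) :: (complex^3^3) set)"
    using assms complex_sequences_lepoll_reals lepoll_trans
    by (intro tracial_unitary_correlations_mono) blast
  then have "\<G> TYPE('a) = (\<Theta> :: (complex^3^3) set)"
    using tracial_unitary_correlations_subset rank_one_hull_subset_tracial_unitary_correlations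
      rank_one_hull_3 by blast
  ultimately show ?thesis
    using extreme_points_correlation_3 rank_one_hull_3 by simp
qed

end
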